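(* Let $(\mathcal{C},\cdot,n)$ be the split Cayley algebra over a field $\mathbb{F}$ of characteristic $3$, with canonical basis $e_1,e_2,u_1,u_2,u_3,v_1,v_2,v_3$, and let $\tau$ be the order $3$ automorphism of $(\mathcal{C},\cdot,n)$ determined by $\tau(u_i)=u_i$, $i=1,2$, and $\tau(u_3)=u_3+u_2+v_3-(e_1-e_2)$. Then the centralizer $\mathbf{Cent}_{\mathbf{Aut}(\mathcal{C},\cdot,n)}(\tau)$ is the unipotent radical $\mathbf{U}$ of the standard Borel subgroup $\mathbf{B}$.
   Context: The split Cayley algebra is the $8$-dimensional unital composition algebra with canonical basis $e_1,e_2,u_1,u_2,u_3,v_1,v_2,v_3$ where $e_1,e_2$ are orthogonal idempotents with $e_1+e_2=1$, $e_1u_i=u_i=u_ie_2$, $e_2v_i=v_i=v_ie_1$, $e_2u_i=u_ie_1=e_1v_i=v_ie_2=0$, $u_iu_{i+1}=v_{i+2}=-u_{i+1}u_i$, $v_iv_{i+1}=u_{i+2}=-v_{i+1}v_i$ (indices modulo $3$), $u_i^2=v_i^2=0$, $u_iv_i=-e_1$, $v_iu_i=-e_2$, $u_iv_j=v_iu_j=0$ for $i\ne j$, and $n(\alpha e_1+\beta e_2+\sum\mu_iu_i+\sum\nu_iv_i)=\alpha\beta+\sum\mu_i\nu_i$. The $u_i$ generate the algebra, so an automorphism is determined by its values on them. Algebraic groups are affine group schemes of finite type over $\mathbb{F}$, viewed as functors on unital commutative associative $\mathbb{F}$-algebras $R$. $\mathbf{Aut}(\mathcal{C},\cdot,n)(R)$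 is the group of automorphisms of $\mathcal{C}\otimes_{\mathbb{F}}R$ over $R$, and the centralizer of $\tau$ is taken scheme-theoretically ($R$-points commuting with $\tau\otimes\mathrm{id}_R$). $\mathbf{T}$ is the maximal torus of automorphisms fixing $e_1,e_2$ and acting by $u_i\mapsto\alpha_iu_i$, $v_i\mapsto\alpha_i^{-1}v_i$, $\alpha_1\alpha_2\alpha_3=1$; $\varepsilon_i$ is the character $\alpha\mapsto\alpha_i$ (additive notation, $\varepsilon_1+\varepsilon_2+\varepsilon_3=0$). The roots are $\pm\varepsilon_i$ and $\varepsilon_i-\varepsilon_j$ ($i\neq j$), with simple roots $\varepsilon_1,\ \varepsilon_2-\varepsilon_1$ and positive roots $\Phi^+=\{\varepsilon_1,\varepsilon_2,-\varepsilon_3,\varepsilon_2-\varepsilon_1,\varepsilon_2-\varepsilon_3,\varepsilon_1-\varepsilon_3\}$. For a root $\alpha$, $\mathbf{U}_\alpha\simeq\mathbf{G}_a$ is the root subgroup; in characteristic $3$ it is $\{\exp(tx_\alpha)\}$, $\exp(\delta)=\mathrm{id}+\delta+\frac12\delta^2$, with $x_{\varepsilon_i-\varepsilon_j}=[L_{u_i},R_{v_j}]$, $x_{\varepsilon_i}=\mathrm{ad}_{u_i}$, $x_{-\varepsilon_i}=-\mathrm{ad}_{v_i}$ ($L,R$ left and right multiplications, $\mathrm{ad}_x(y)=x\cdot y-y\cdot x$). The standard Borel subgroup $\mathbf{B}$ is generated by $\mathbf{T}$ and the $\mathbf{U}_\alpha$, $\alpha\in\Phi^+$; its unipotent radical $\mathbf{U}$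 is generated by the $\mathbf{U}_\alpha$, $\alpha\in\Phi^+$. *)

theory Defs
  imports
    "HOL-Analysis.Finite_Cartesian_Product"
    "HOL-Library.Numeral_Type"
    "HOL-Algebra.Generated_Groups"
    "HOL-Algebra.Multiplicative_Group"
begin

text \<open>Labels of the canonical basis.  The indices live in the ring \<open>3\<close> of integers modulo 3,
  so that \<open>i + 1\<close> and \<open>i + 2\<close> are taken modulo 3 and the third index, \<open>3\<close>, equals \<open>0\<close>.\<close>

datatype cbasis = E1 | E2 | U 3 | V 3

lemma UNIV_cbasis: "(UNIV :: cbasis set) = {E1, E2} \<union> range U \<union> range V"
proof -
  have "b \<in> {E1, E2} \<union> range U \<union> range V" for b
    by (cases b) auto
  then show ?thesis by blast
qed

instance cbasis :: finite
  by standard (simp add: UNIV_cbasis)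

text \<open>The structure constants are integers, so for a commutative \<open>F\<close>-algebra \<open>R\<close> the algebra
  \<open>C \<otimes> R\<close> is \<open>R ^ cbasis\<close> with the same multiplication table; \<open>C\<close> itself is the case \<open>R = F\<close>.\<close>

abbreviation basis_elt :: "cbasis \<Rightarrow> 'a::comm_ring_1 ^ cbasis" where
  "basis_elt b \<equiv> axis b 1"

fun basis_mult :: "cbasis \<Rightarrow> cbasis \<Rightarrow> 'a::comm_ring_1 ^ cbasis" where
  "basis_mult E1 E1 = basis_elt E1"
| "basis_mult E1 E2 = 0"
| "basis_mult E2 E1 = 0"
| "basis_mult E2 E2 = basis_elt E2"
| "basis_mult E1 (U i) = basis_elt (U i)"
| "basis_mult (U i) E2 = basis_elt (U i)"
| "basis_mult E2 (V i) = basis_elt (V i)"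
| "basis_mult (V i) E1 = basis_elt (V i)"
| "basis_mult E2 (U i) = 0"
| "basis_mult (U i) E1 = 0"
| "basis_mult E1 (V i) = 0"
| "basis_mult (V i) E2 = 0"
| "basis_mult (U i) (U j) =
     (if j = i + 1 then basis_elt (V (i + 2))
      else if i = j + 1 then - basis_elt (V (j + 2)) else 0)"
| "basis_mult (V i) (V j) =
     (if j = i + 1 then basis_elt (U (i + 2))
      else if i = j + 1 then - basis_elt (U (j + 2)) else 0)"
| "basis_mult (U i) (V j) = (if i = j then - basis_elt E1 else 0)"
| "basis_mult (V i) (U j) = (if i = j then - basis_elt E2 else 0)"

definition cayley_mult ::
  "'a::comm_ring_1 ^ cbasis \<Rightarrow> 'a ^ cbasis \<Rightarrow> 'a ^ cbasis" (infixl \<open>\<odot>\<close> 70)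
  where "x \<odot> y = (\<Sum>i\<in>UNIV. \<Sum>j\<in>UNIV. (x $ i * y $ j) *s basis_mult i j)"

definition cayley_norm :: "'a::comm_ring_1 ^ cbasis \<Rightarrow> 'a" where
  "cayley_norm x = x $ E1 * x $ E2 + (\<Sum>i\<in>UNIV. x $ U i * x $ V i)"

definition cayley_Aut :: "('a::comm_ring_1 ^ cbasis \<Rightarrow> 'a ^ cbasis) monoid" where
  "cayley_Aut =
     \<lparr>carrier = {f. module_hom (*s) (*s) f \<and> bij f \<and>
                    (\<forall>x y. f (x \<odot> y) = f x \<odot> f y) \<and>
                    (\<forall>x. cayley_norm (f x) = cayley_norm x)},
      mult = (\<circ>), one = id\<rparr>"

lemma group_cayley_Aut: "group (cayley_Aut :: ('a::comm_ring_1 ^ cbasis \<Rightarrow> 'a ^ cbasis) monoid)"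
proof (rule groupI)
  let ?G = "cayley_Aut :: ('a ^ cbasis \<Rightarrow> 'a ^ cbasis) monoid"
  have mod: "Modules.module ((*s) :: 'a \<Rightarrow> 'a ^ cbasis \<Rightarrow> 'a ^ cbasis)"
    by unfold_locales (simp_all add: vec_eq_iff algebra_simps)
  have hom_iff: "module_hom (*s) (*s) f \<longleftrightarrow>
      (\<forall>x y. f (x + y) = f x + f y) \<and> (\<forall>r x. f (r *s x) = r *s f x)"
    for f :: "'a ^ cbasis \<Rightarrow> 'a ^ cbasis"
    using mod by (auto simp: module_hom_def module_hom_axioms_def)
  show "f \<otimes>\<^bsub>?G\<^esub> g \<in> carrier ?G" if "f \<in> carrier ?G" "g \<in> carrier ?G" for f g
    using that by (auto simp: cayley_Aut_def hom_iff intro: bij_comp)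
  show "\<one>\<^bsub>?G\<^esub> \<in> carrier ?G"
    by (auto simp: cayley_Aut_def hom_iff)
  show "f \<otimes>\<^bsub>?G\<^esub> g \<otimes>\<^bsub>?G\<^esub> h = f \<otimes>\<^bsub>?G\<^esub> (g \<otimes>\<^bsub>?G\<^esub> h)" for f g h
    by (simp add: cayley_Aut_def comp_assoc)
  show "\<one>\<^bsub>?G\<^esub> \<otimes>\<^bsub>?G\<^esub> f = f" for f
    by (simp add: cayley_Aut_def)
  show "\<exists>g\<in>carrier ?G. g \<otimes>\<^bsub>?G\<^esub> f = \<one>\<^bsub>?G\<^esub>" if f: "f \<in> carrier ?G" for f
  proof
    have b: "bij f" and add: "\<And>x y. f (x + y) = f x + f y"
      and scl: "\<And>r x. f (r *s x) = r *s f x" and mul: "\<And>x y. f (x \<odot> y) = f x \<odot> f y"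
      and nrm: "\<And>x. cayley_norm (f x) = cayley_norm x"
      using f by (auto simp: cayley_Aut_def hom_iff)
    have fi: "f (inv_into UNIV f y) = y" for y
      using b by (simp add: bij_is_surj surj_f_inv_f)
    have inj: "x = y" if "f x = f y" for x y
      using b that by (simp add: bij_is_inj inj_eq)
    show "inv_into UNIV f \<in> carrier ?G"
      unfolding cayley_Aut_def hom_iff
    proof (simp, intro conjI allI)
      show "inv_into UNIV f (x + y) = inv_into UNIV f x + inv_into UNIV f y" for x y
        by (rule inj) (simp add: fi add)
      show "inv_into UNIV f (r *s x) = r *s inv_into UNIV f x" for r x
        by (rule inj) (simp add: fi scl)
      show "bij (inv_into UNIV f)"
        using b by (rule bij_imp_bij_inv)
      show "inv_into UNIV f (x \<odot> y) = inv_into UNIV f x \<odot> inv_into UNIV f y" for x y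
        by (rule inj) (simp add: fi mul)
      show "cayley_norm (inv_into UNIV f x) = cayley_norm x" for x
        using nrm[of "inv_into UNIV f x"] by (simp add: fi)
    qed
    show "inv_into UNIV f \<otimes>\<^bsub>?G\<^esub> f = \<one>\<^bsub>?G\<^esub>"
      using b by (simp add: cayley_Aut_def bij_is_inj)
  qed
qed

text \<open>The class \<open>comm_ring_1\<close> leaves out the zero ring only, over which every group scheme has
  exactly one point.\<close>

locale comm_algebra = vector_space sc
  for sc :: "'f::field \<Rightarrow> 'r::comm_ring_1 \<Rightarrow> 'r" +
  assumes scale_mult_left: "sc a x * y = sc a (x * y)"

text \<open>The base change \<open>f \<otimes> id\<close> to \<open>R\<close> of a linear endomorphism \<open>f\<close> of \<open>C\<close>.\<close>

definition base_change ::
  "('f::field \<Rightarrow> 'r::comm_ring_1 \<Rightarrow> 'r) \<Rightarrow> ('f ^ cbasis \<Rightarrow> 'f ^ cbasis)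
     \<Rightarrow> 'r ^ cbasis \<Rightarrow> 'r ^ cbasis"
  where "base_change sc f x =
    (\<Sum>j\<in>UNIV. x $ j *s (\<chi> i. sc (f (basis_elt j) $ i) 1))"

text \<open>The \<open>R\<close>-points of the scheme-theoretic centralizer of an automorphism \<open>\<tau>\<close> of \<open>C\<close>.\<close>

definition centralizer_points ::
  "('f::field \<Rightarrow> 'r::comm_ring_1 \<Rightarrow> 'r) \<Rightarrow> ('f ^ cbasis \<Rightarrow> 'f ^ cbasis)
     \<Rightarrow> ('r ^ cbasis \<Rightarrow> 'r ^ cbasis) set"
  where "centralizer_points sc \<tau> =
    {g \<in> carrier cayley_Aut. g \<circ> base_change sc \<tau> = base_change sc \<tau> \<circ> g}"

text \<open>\<open>Eps i\<close>, \<open>NegEps i\<close> and \<open>EpsDiff i j\<close> stand for the roots \<open>\<epsilon>\<^sub>i\<close>, \<open>-\<epsilon>\<^sub>i\<close> and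
  \<open>\<epsilon>\<^sub>i - \<epsilon>\<^sub>j\<close>; the last is a root only for \<open>i \<noteq> j\<close>.\<close>

datatype root = Eps 3 | NegEps 3 | EpsDiff 3 3

definition positive_roots :: "root set" where
  "positive_roots = {Eps 1, Eps 2, NegEps 3, EpsDiff 2 1, EpsDiff 2 3, EpsDiff 1 3}"

definition cayley_ad :: "'a::comm_ring_1 ^ cbasis \<Rightarrow> 'a ^ cbasis \<Rightarrow> 'a ^ cbasis" where
  "cayley_ad x y = x \<odot> y - y \<odot> x"

text \<open>In the last equation, \<open>[L\<^sub>a, R\<^sub>b] y = a (y b) - (a y) b\<close> with \<open>a = u\<^sub>i\<close>, \<open>b = v\<^sub>j\<close>.\<close>

fun root_vector :: "root \<Rightarrow> 'a::comm_ring_1 ^ cbasis \<Rightarrow> 'a ^ cbasis" where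
  "root_vector (Eps i) y = cayley_ad (basis_elt (U i)) y"
| "root_vector (NegEps i) y = - cayley_ad (basis_elt (V i)) y"
| "root_vector (EpsDiff i j) y =
     basis_elt (U i) \<odot> (y \<odot> basis_elt (V j)) - (basis_elt (U i) \<odot> y) \<odot> basis_elt (V j)"

definition exp_trunc ::
  "('f::field \<Rightarrow> 'r::comm_ring_1 \<Rightarrow> 'r) \<Rightarrow> ('r ^ cbasis \<Rightarrow> 'r ^ cbasis)
     \<Rightarrow> 'r ^ cbasis \<Rightarrow> 'r ^ cbasis"
  where "exp_trunc sc \<delta> x = x + \<delta> x + sc (1 / 2) 1 *s \<delta> (\<delta> x)"

definition root_subgroup ::
  "('f::field \<Rightarrow> 'r::comm_ring_1 \<Rightarrow> 'r) \<Rightarrow> root \<Rightarrow> ('r ^ cbasis \<Rightarrow> 'r ^ cbasis) set"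
  where "root_subgroup sc \<alpha> = {exp_trunc sc (\<lambda>x. t *s root_vector \<alpha> x) | t. True}"

text \<open>The \<open>R\<close>-points of the unipotent radical of the standard Borel subgroup.  Multiplication
  is an isomorphism of schemes from the product of the positive root subgroups (in any fixed
  order) onto the unipotent radical, so its \<open>R\<close>-points are generated, for each \<open>R\<close>, by those of
  the positive root subgroups.\<close>

definition unipotent_radical ::
  "('f::field \<Rightarrow> 'r::comm_ring_1 \<Rightarrow> 'r) \<Rightarrow> ('r ^ cbasis \<Rightarrow> 'r ^ cbasis) set"
  where "unipotent_radical sc =
    generate cayley_Aut (\<Union>\<alpha>\<in>positive_roots. root_subgroup sc \<alpha>)"

definition is_tau :: "('f::field ^ cbasis \<Rightarrow> 'f ^ cbasis) \<Rightarrow> bool" where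
  "is_tau \<tau> \<longleftrightarrow> \<tau> \<in> carrier cayley_Aut \<and>
     \<tau> (basis_elt (U 1)) = basis_elt (U 1) \<and>
     \<tau> (basis_elt (U 2)) = basis_elt (U 2) \<and>
     \<tau> (basis_elt (U 3)) =
       basis_elt (U 3) + basis_elt (U 2) + basis_elt (V 3) - (basis_elt E1 - basis_elt E2)"

end

theory Submission
  imports Defs "HOL-Analysis.Cartesian_Space"
begin

text \<open>
  Everything is computed in coordinates over a commutative ring \<open>R\<close> in which \<open>3 = 0\<close>.  Let \<open>g\<close> be
  an automorphism commuting with \<open>\<tau>\<close>.  It preserves the traceless vectors fixed by \<open>\<tau>\<close>, the span
  of \<open>u\<^sub>1, u\<^sub>2, v\<^sub>3\<close>.  Comparing coordinates in \<open>g (\<tau> u\<^sub>3) = \<tau> (g u\<^sub>3)\<close>, where \<open>e\<^sub>1 = - u\<^sub>3 v\<^sub>3\<close> and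
  \<open>e\<^sub>2 = - v\<^sub>3 u\<^sub>3\<close>, and using that \<open>g\<close> preserves the norm, one finds that \<open>g u\<^sub>1, g u\<^sub>2, g u\<^sub>3\<close> depend
  on six free parameters only.  A product of the six positive root elements has values of the same
  shape, and the parameters of the factors can be solved for successively.  Conversely, \<open>\<tau>\<close> is a
  product of elements of the highest long and highest short root subgroups, and in characteristic
  3 both commute with every positive root element.
\<close>

section \<open>Coordinates in the canonical basis\<close>

definition cayley_vec ::
  "'a::comm_ring_1 \<Rightarrow> 'a \<Rightarrow> 'a \<Rightarrow> 'a \<Rightarrow> 'a \<Rightarrow> 'a \<Rightarrow> 'a \<Rightarrow> 'a \<Rightarrow> 'a ^ cbasis"
  where "cayley_vec a b m1 m2 m3 n1 n2 n3 = (\<chi> k. case k of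
     E1 \<Rightarrow> a | E2 \<Rightarrow> b
   | U i \<Rightarrow> if i = 1 then m1 else if i = 2 then m2 else m3
   | V i \<Rightarrow> if i = 1 then n1 else if i = 2 then n2 else n3)"

lemma cayley_vec_nth [simp]:
  "cayley_vec a b m1 m2 m3 n1 n2 n3 $ E1 = a"
  "cayley_vec a b m1 m2 m3 n1 n2 n3 $ E2 = b"
  "cayley_vec a b m1 m2 m3 n1 n2 n3 $ U 1 = m1"
  "cayley_vec a b m1 m2 m3 n1 n2 n3 $ U 2 = m2"
  "cayley_vec a b m1 m2 m3 n1 n2 n3 $ U 3 = m3"
  "cayley_vec a b m1 m2 m3 n1 n2 n3 $ V 1 = n1"
  "cayley_vec a b m1 m2 m3 n1 n2 n3 $ V 2 = n2"
  "cayley_vec a b m1 m2 m3 n1 n2 n3 $ V 3 = n3"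
  by (simp_all add: cayley_vec_def)

lemma forall_cbasis:
  "(\<forall>k. P k) \<longleftrightarrow> P E1 \<and> P E2 \<and> P (U 1) \<and> P (U 2) \<and> P (U 3) \<and> P (V 1) \<and> P (V 2) \<and> P (V 3)"
  by (metis cbasis.exhaust exhaust_3)

lemma sum_cbasis:
  "(\<Sum>k\<in>UNIV. f k) = f E1 + f E2 + f (U 1) + f (U 2) + f (U 3) + f (V 1) + f (V 2) + f (V 3)"
proof -
  have UNIV_eq: "(UNIV :: cbasis set) = {E1, E2, U 1, U 2, U 3, V 1, V 2, V 3}"
    by (auto simp: UNIV_cbasis UNIV_3)
  show ?thesis
    unfolding UNIV_eq by (simp add: add.assoc)
qed

lemma cayley_vec_eq_iff [simp]:
  "cayley_vec a b m1 m2 m3 n1 n2 n3 = cayley_vec a' b' m1' m2' m3' n1' n2' n3' \<longleftrightarrow>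
     a = a' \<and> b = b' \<and> m1 = m1' \<and> m2 = m2' \<and> m3 = m3' \<and> n1 = n1' \<and> n2 = n2' \<and> n3 = n3'"
  by (simp add: vec_eq_iff forall_cbasis)

lemma cayley_vec_cases [case_names cayley_vec]:
  obtains a b m1 m2 m3 n1 n2 n3 where "x = cayley_vec a b m1 m2 m3 n1 n2 n3"
proof
  show "x = cayley_vec (x $ E1) (x $ E2) (x $ U 1) (x $ U 2) (x $ U 3)
      (x $ V 1) (x $ V 2) (x $ V 3)"
    by (simp add: vec_eq_iff forall_cbasis)
qed

lemma cayley_vec_induct [case_names cayley_vec]:
  "(\<And>a b m1 m2 m3 n1 n2 n3. P (cayley_vec a b m1 m2 m3 n1 n2 n3)) \<Longrightarrow> P x"
  by (cases x rule: cayley_vec_cases) simp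

lemma basis_elt_cayley_vec:
  "basis_elt E1 = cayley_vec 1 0 0 0 0 0 0 0"
  "basis_elt E2 = cayley_vec 0 1 0 0 0 0 0 0"
  "basis_elt (U 1) = cayley_vec 0 0 1 0 0 0 0 0"
  "basis_elt (U 2) = cayley_vec 0 0 0 1 0 0 0 0"
  "basis_elt (U 3) = cayley_vec 0 0 0 0 1 0 0 0"
  "basis_elt (V 1) = cayley_vec 0 0 0 0 0 1 0 0"
  "basis_elt (V 2) = cayley_vec 0 0 0 0 0 0 1 0"
  "basis_elt (V 3) = cayley_vec 0 0 0 0 0 0 0 1"
  by (simp_all add: vec_eq_iff forall_cbasis axis_def)

lemma cayley_vec_arith:
  "cayley_vec a b m1 m2 m3 n1 n2 n3 + cayley_vec a' b' m1' m2' m3' n1' n2' n3' =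
     cayley_vec (a + a') (b + b') (m1 + m1') (m2 + m2') (m3 + m3') (n1 + n1') (n2 + n2') (n3 + n3')"
  "cayley_vec a b m1 m2 m3 n1 n2 n3 - cayley_vec a' b' m1' m2' m3' n1' n2' n3' =
     cayley_vec (a - a') (b - b') (m1 - m1') (m2 - m2') (m3 - m3') (n1 - n1') (n2 - n2') (n3 - n3')"
  "- cayley_vec a b m1 m2 m3 n1 n2 n3 =
     cayley_vec (- a) (- b) (- m1) (- m2) (- m3) (- n1) (- n2) (- n3)"
  "r *s cayley_vec a b m1 m2 m3 n1 n2 n3 =
     cayley_vec (r * a) (r * b) (r * m1) (r * m2) (r * m3) (r * n1) (r * n2) (r * n3)"
  by (simp_all add: vec_eq_iff forall_cbasis)

text \<open>Evaluating \<open>i + 1\<close> and \<open>i + 2\<close> in \<open>basis_mult\<close>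
  produces these numerals as indices.\<close>

lemma numeral_mod_3: "(4 :: 3) = 1" "(5 :: 3) = 2"
  by simp_all

lemma cayley_mult_nth:
  "(x \<odot> y) $ k = (\<Sum>i\<in>UNIV. \<Sum>j\<in>UNIV. x $ i * y $ j * basis_mult i j $ k)"
  by (simp add: cayley_mult_def)

text \<open>This is Zorn's vector matrix form: dot products in the two idempotent coordinates, cross
  products of two u-blocks or two v-blocks.\<close>

lemma cayley_mult_cayley_vec:
  "cayley_vec a b m1 m2 m3 n1 n2 n3 \<odot> cayley_vec a' b' m1' m2' m3' n1' n2' n3' =
     cayley_vec
       (a * a' - m1 * n1' - m2 * n2' - m3 * n3')
       (b * b' - n1 * m1' - n2 * m2' - n3 * m3')
       (a * m1' + m1 * b' + n2 * n3' - n3 * n2')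
       (a * m2' + m2 * b' + n3 * n1' - n1 * n3')
       (a * m3' + m3 * b' + n1 * n2' - n2 * n1')
       (b * n1' + n1 * a' + m2 * m3' - m3 * m2')
       (b * n2' + n2 * a' + m3 * m1' - m1 * m3')
       (b * n3' + n3 * a' + m1 * m2' - m2 * m1')"
  unfolding vec_eq_iff forall_cbasis cayley_mult_nth sum_cbasis basis_mult.simps
  by (simp add: axis_def numeral_mod_3)

lemma cayley_norm_cayley_vec:
  "cayley_norm (cayley_vec a b m1 m2 m3 n1 n2 n3) = a * b + m1 * n1 + m2 * n2 + m3 * n3"
  by (simp add: cayley_norm_def sum_3 add.assoc)

lemmas cayley_vec_simps =
  cayley_mult_cayley_vec cayley_norm_cayley_vec cayley_vec_arith basis_elt_cayley_vec

section \<open>Automorphisms of the Cayley algebra\<close>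

lemma module_vec: "Modules.module ((*s) :: 'a::comm_ring_1 \<Rightarrow> 'a ^ 'n \<Rightarrow> 'a ^ 'n)"
  by unfold_locales (simp_all add: vec_eq_iff algebra_simps)

lemma module_hom_vec_iff:
  "module_hom (*s) (*s) f \<longleftrightarrow> (\<forall>x y. f (x + y) = f x + f y) \<and> (\<forall>r x. f (r *s x) = r *s f x)"
  for f :: "'a::comm_ring_1 ^ 'n \<Rightarrow> 'a ^ 'n"
  using module_vec[where 'a = 'a and 'n = 'n] by (auto simp: module_hom_def module_hom_axioms_def)

lemma cayley_Aut_iff:
  "f \<in> carrier cayley_Aut \<longleftrightarrow>
     (\<forall>x y. f (x + y) = f x + f y) \<and> (\<forall>r x. f (r *s x) = r *s f x) \<and> bij f \<and>
     (\<forall>x y. f (x \<odot> y) = f x \<odot> f y) \<and> (\<forall>x. cayley_norm (f x) = cayley_norm x)"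
  by (simp add: cayley_Aut_def module_hom_vec_iff conj_assoc)

text \<open>The \<open>u_i\<close> generate: products of two of them give the \<open>v_i\<close>,
  and \<open>u_1 v_1\<close>, \<open>v_1 u_1\<close> give \<open>e_1\<close>, \<open>e_2\<close> up
  to sign.\<close>

lemma cayley_Aut_eqI:
  fixes f g :: "'a::comm_ring_1 ^ cbasis \<Rightarrow> 'a ^ cbasis"
  assumes f: "f \<in> carrier cayley_Aut" and g: "g \<in> carrier cayley_Aut"
    and eq: "\<And>i. f (basis_elt (U i)) = g (basis_elt (U i))"
  shows "f = g"
proof
  fix x :: "'a ^ cbasis"
  define agree where "agree y \<longleftrightarrow> f y = g y" for y
  have add: "agree (y + z)" and mult: "agree (y \<odot> z)" if "agree y" "agree z" for y z
    using f g that by (simp_all add: agree_def cayley_Aut_iff)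
  have scale: "agree (r *s y)" if "agree y" for r y
    using f g that by (simp add: agree_def cayley_Aut_iff)
  have u: "agree (basis_elt (U i))" for i
    using eq by (simp add: agree_def)
  have "basis_elt (V 1) = basis_elt (U 2) \<odot> basis_elt (U 3)"
    "basis_elt (V 2) = basis_elt (U 3) \<odot> basis_elt (U 1)"
    "basis_elt (V 3) = basis_elt (U 1) \<odot> basis_elt (U 2)"
    by (simp_all add: cayley_vec_simps)
  then have v: "agree (basis_elt (V 1))" "agree (basis_elt (V 2))" "agree (basis_elt (V 3))"
    by (metis mult u)+
  have "basis_elt E1 = (- 1) *s (basis_elt (U 1) \<odot> basis_elt (V 1))"
    "basis_elt E2 = (- 1) *s (basis_elt (V 1) \<odot> basis_elt (U 1))"
    by (simp_all add: cayley_vec_simps)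
  then have e: "agree (basis_elt E1)" "agree (basis_elt E2)"
    by (metis mult scale u v(1))+
  have "x = x $ E1 *s basis_elt E1 + x $ E2 *s basis_elt E2
      + x $ U 1 *s basis_elt (U 1) + x $ U 2 *s basis_elt (U 2) + x $ U 3 *s basis_elt (U 3)
      + x $ V 1 *s basis_elt (V 1) + x $ V 2 *s basis_elt (V 2) + x $ V 3 *s basis_elt (V 3)"
    by (cases x rule: cayley_vec_cases) (simp add: cayley_vec_simps)
  also have "agree \<dots>"
    by (intro add scale u v e)
  finally show "f x = g x"
    by (simp add: agree_def)
qed

text \<open>Preserving the unit is not part of \<open>cayley_Aut\<close>; it follows from
  surjectivity, by multiplying with a preimage of the unit.\<close>

lemma cayley_Aut_one:
  assumes f: "f \<in> carrier cayley_Aut"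
  shows "f (cayley_vec 1 1 0 0 0 0 0 0) = cayley_vec 1 1 0 0 0 0 0 0" (is "f ?e = _")
proof -
  have unit: "?e \<odot> x = x" "x \<odot> ?e = x" for x
    by (cases x rule: cayley_vec_cases; simp add: cayley_vec_simps)+
  have "surj f"
    using f by (simp add: cayley_Aut_iff bij_is_surj)
  then obtain y where y: "f y = ?e"
    by (metis surjD)
  have "f ?e = f ?e \<odot> f y"
    by (simp add: y unit)
  also have "\<dots> = f (?e \<odot> y)"
    using f by (simp add: cayley_Aut_iff)
  finally show ?thesis
    by (simp add: y unit)
qed

text \<open>The trace is the polar form of the norm at the unit, and both the norm and the unit are
  preserved.\<close>

lemma cayley_Aut_trace:
  assumes f: "f \<in> carrier cayley_Aut"
  shows "f x $ E1 + f x $ E2 = x $ E1 + x $ E2"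
proof -
  let ?e = "cayley_vec 1 1 0 0 0 0 0 0"
  have norm_add_one: "cayley_norm (y + ?e) = cayley_norm y + (y $ E1 + y $ E2) + 1" for y
    by (induction y rule: cayley_vec_induct) (simp add: cayley_vec_simps algebra_simps)
  have "f (x + ?e) = f x + ?e"
    using f cayley_Aut_one[OF f] by (simp add: cayley_Aut_iff)
  moreover have norm: "cayley_norm (f y) = cayley_norm y" for y
    using f by (simp add: cayley_Aut_iff)
  ultimately have "cayley_norm (f x + ?e) = cayley_norm (x + ?e)"
    by metis
  then show ?thesis
    by (simp add: norm_add_one norm)
qed

section \<open>Arithmetic modulo 3 and the automorphism \<open>tau_map\<close>\<close>

lemma char3_numerals:
  assumes "(3 :: 'a::comm_ring_1) = 0"
  shows "(2 :: 'a) = - 1" "(3 :: 'a) = 0" "(4 :: 'a) = 1" "(5 :: 'a) = - 1" "(6 :: 'a) = 0"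
proof -
  show "(3 :: 'a) = 0"
    by (fact assms)
  have "(2 :: 'a) = 3 - 1"
    by simp
  then show two: "(2 :: 'a) = - 1"
    unfolding assms by simp
  have "(4 :: 'a) = 3 + 1"
    by simp
  then show "(4 :: 'a) = 1"
    unfolding assms by simp
  have "(5 :: 'a) = 3 + 2"
    by simp
  then show "(5 :: 'a) = - 1"
    unfolding assms two by simp
  have "(6 :: 'a) = 3 + 3"
    by simp
  then show "(6 :: 'a) = 0"
    unfolding assms by simp
qed

text \<open>The automorphism \<open>\<tau>\<close>, computed from its values on the generators \<open>u\<^sub>i\<close>.\<close>

definition tau_map :: "'a::comm_ring_1 ^ cbasis \<Rightarrow> 'a ^ cbasis" where
  "tau_map x = cayley_vec (x $ E1 - x $ U 3) (x $ E2 + x $ U 3) (x $ U 1 - x $ V 2)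
     (x $ U 2 + x $ V 1 + x $ U 3) (x $ U 3) (x $ V 1) (x $ V 2)
     (x $ U 3 + x $ V 3 - x $ E1 + x $ E2 - x $ V 2)"

text \<open>For \<open>N = tau_map - id\<close> one has \<open>N^3 = 0\<close>, so the cube is
  \<open>id + 3 N + 3 N^2\<close>.\<close>

lemma tau_map_cube:
  assumes three: "(3 :: 'a::comm_ring_1) = 0"
  shows "tau_map (tau_map (tau_map x)) = (x :: 'a ^ cbasis)"
  by (induction x rule: cayley_vec_induct) (simp add: tau_map_def char3_numerals[OF three])

lemma tau_map_in_Aut:
  assumes three: "(3 :: 'a::comm_ring_1) = 0"
  shows "(tau_map :: 'a ^ cbasis \<Rightarrow> 'a ^ cbasis) \<in> carrier cayley_Aut"
proof -
  have "bij (tau_map :: 'a ^ cbasis \<Rightarrow> 'a ^ cbasis)"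
    by (rule o_bij[where g = "tau_map \<circ> tau_map"]) (simp_all add: fun_eq_iff tau_map_cube[OF three])
  moreover have "tau_map (x + y) = tau_map x + tau_map y"
    "tau_map (x \<odot> y) = tau_map x \<odot> tau_map y" for x y :: "'a ^ cbasis"
    by (induction x rule: cayley_vec_induct; induction y rule: cayley_vec_induct;
        simp add: tau_map_def cayley_vec_simps algebra_simps)+
  moreover have "tau_map (r *s x) = r *s tau_map x"
    "cayley_norm (tau_map x) = cayley_norm x" for r and x :: "'a ^ cbasis"
    by (induction x rule: cayley_vec_induct; simp add: tau_map_def cayley_vec_simps algebra_simps)+
  ultimately show "(tau_map :: 'a ^ cbasis \<Rightarrow> 'a ^ cbasis) \<in> carrier cayley_Aut"
    by (simp add: cayley_Aut_iff)
qed

text \<open>Six parameters remain, as many as there are positive roots. All equations are solved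
  without cancelling, since \<open>R\<close> may have zero divisors.\<close>

lemma centralizer_tau_map_values:
  fixes g :: "'a::comm_ring_1 ^ cbasis \<Rightarrow> 'a ^ cbasis"
  assumes three: "(3 :: 'a) = 0" and g: "g \<in> carrier cayley_Aut"
    and comm: "\<And>x. g (tau_map x) = tau_map (g x)"
  obtains b c d p s1 s2 where
    "g (basis_elt (U 1)) = cayley_vec 0 0 1 b 0 0 0 c"
    "g (basis_elt (U 2)) = cayley_vec 0 0 0 1 0 0 0 d"
    "g (basis_elt (U 3)) = cayley_vec p (- p) s1 s2 1 (b * d - c) (- d)
       (p * p - s1 * (b * d - c) + s2 * d)"
proof -
  note num [simp] = char3_numerals[OF three]
  let ?u1 = "basis_elt (U 1) :: 'a ^ cbasis"
    and ?u2 = "basis_elt (U 2) :: 'a ^ cbasis"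
    and ?u3 = "basis_elt (U 3) :: 'a ^ cbasis"
    and ?v3 = "basis_elt (V 3) :: 'a ^ cbasis"
  have add: "g (x + y) = g x + g y" and scale: "g (r *s x) = r *s g x"
    and mult: "g (x \<odot> y) = g x \<odot> g y" and norm: "cayley_norm (g x) = cayley_norm x" for r x y
    using g by (simp_all add: cayley_Aut_iff)
  \<comment> \<open>A vector fixed by \<open>tau_map\<close> has no \<open>u_3\<close>,
    \<open>v_1\<close>, \<open>v_2\<close> coordinates and equal idempotent coordinates
    \<open>a\<close>. Trace zero then reads \<open>2 a = 0\<close>, and
    \<open>2 = - 1\<close>.\<close>
  have fixed: "\<exists>m1 m2 n3. g x = cayley_vec 0 0 m1 m2 0 0 0 n3"
    if "tau_map x = x" "x $ E1 + x $ E2 = 0" for x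
  proof -
    have tau: "tau_map (g x) = g x"
      using comm[of x] that(1) by simp
    have "g x $ E1 + g x $ E2 = 0"
      using cayley_Aut_trace[OF g, of x] that(2) by simp
    with tau show ?thesis
      by (cases "g x" rule: cayley_vec_cases) (auto simp: tau_map_def algebra_simps)
  qed
  obtain b11 b12 c where u1: "g ?u1 = cayley_vec 0 0 b11 b12 0 0 0 c"
    using fixed[of ?u1] by (auto simp: tau_map_def cayley_vec_simps)
  obtain b21 b22 d where u2: "g ?u2 = cayley_vec 0 0 b21 b22 0 0 0 d"
    using fixed[of ?u2] by (auto simp: tau_map_def cayley_vec_simps)
  obtain p q s1 s2 s3 r1 r2 r3 where u3: "g ?u3 = cayley_vec p q s1 s2 s3 r1 r2 r3"
    by (rule cayley_vec_cases)
  have q: "q = - p"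
    using cayley_Aut_trace[OF g, of ?u3] unfolding u3
    by (simp add: basis_elt_cayley_vec eq_neg_iff_add_eq_0 add.commute)
  \<comment> \<open>Since \<open>v_3 = u_1 u_2\<close>, this minor is the factor by which
    \<open>g\<close> scales \<open>v_3\<close>.\<close>
  define e where "e = b11 * b22 - b12 * b21"
  have v3: "g ?v3 = cayley_vec 0 0 0 0 0 0 0 e"
    using mult[of ?u1 ?u2] unfolding u1 u2 by (simp add: cayley_vec_simps e_def)
  have norm_u3: "p * q + s1 * r1 + s2 * r2 + s3 * r3 = 0"
    using norm[of ?u3] unfolding u3 by (simp add: cayley_vec_simps)
  \<comment> \<open>The polar form of \<open>u_3\<close> and \<open>v_3\<close> is 1, and
    \<open>g\<close> preserves it.\<close>
  have "s3 * e = 1"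
    using norm[of "?u3 + ?v3"] norm_u3 unfolding add u3 v3
    by (simp add: cayley_vec_simps algebra_simps)
  \<comment> \<open>Writing \<open>- (e_1 - e_2)\<close> as a commutator of \<open>u_3\<close> and
    \<open>v_3\<close> expresses the image under \<open>g\<close> by the values already
    named.\<close>
  have "tau_map ?u3 = ?u3 + ?u2 + ?v3 + (?u3 \<odot> ?v3 + (- 1) *s (?v3 \<odot> ?u3))"
    by (simp add: tau_map_def cayley_vec_simps)
  then have "g ?u3 + g ?u2 + g ?v3 + (g ?u3 \<odot> g ?v3 + (- 1) *s (g ?v3 \<odot> g ?u3)) = tau_map (g ?u3)"
    using comm[of ?u3] by (simp only: add scale mult)
  then have eqs: "s3 * e = s3" "b21 + r2 * e + r2 * e = - r2" "b22 - r1 * e - r1 * e = r1 + s3"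
    "d + e + q * e - p * e = s3 - p + q - r2"
    unfolding u2 u3 v3 by (simp_all add: cayley_vec_simps tau_map_def algebra_simps)
  have s3: "s3 = 1"
    using eqs(1) \<open>s3 * e = 1\<close> by simp
  with \<open>s3 * e = 1\<close> have e: "e = 1"
    by simp
  \<comment> \<open>With \<open>e = 1\<close> the equation reads \<open>b21 = - 3 * r2\<close>; the
    next one reads \<open>b22 = s3 + 3 * r1\<close>.\<close>
  have b21: "b21 = 0"
    using eqs(2) by (simp add: e algebra_simps)
  have b22: "b22 = 1"
    using eqs(3) by (simp add: e s3 algebra_simps)
  have b11: "b11 = 1"
    using e by (simp add: e_def b21 b22)
  have r2: "r2 = - d"
    using eqs(4) by (simp add: e s3 q eq_neg_iff_add_eq_0 algebra_simps)
  \<comment> \<open>The left side is the polar form of \<open>g u_1\<close> and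
    \<open>g u_3\<close>, which vanishes because \<open>u_1\<close> and \<open>u_3\<close> are
    orthogonal.\<close>
  have "r1 + b12 * r2 + c
      = cayley_norm (g (?u1 + ?u3)) - (p * q + s1 * r1 + s2 * r2 + s3 * r3)"
    unfolding add u1 u3 by (simp add: cayley_vec_simps b11 s3 algebra_simps)
  also have "\<dots> = 0"
    by (simp add: norm norm_u3 cayley_vec_simps)
  finally have "r1 + b12 * r2 + c = 0" .
  then have r1: "r1 = b12 * d - c"
    by (simp add: r2 algebra_simps)
  have "r3 = p * p - s1 * r1 - s2 * r2 + (p * q + s1 * r1 + s2 * r2 + s3 * r3)"
    by (simp add: q s3)
  then have r3: "r3 = p * p - s1 * (b12 * d - c) + s2 * d"
    unfolding norm_u3 by (simp add: r1 r2)
  show thesis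
    using that[of b12 c d p s1 s2] by (simp add: u1 u2 u3 b11 b21 b22 q s3 r1 r2 r3)
qed

text \<open>Existence is the explicit \<open>tau_map\<close>; uniqueness holds because the
  \<open>u_i\<close> generate.\<close>

lemma is_tau_iff:
  assumes three: "(3 :: 'f::field) = 0"
  shows "is_tau (\<tau> :: 'f ^ cbasis \<Rightarrow> 'f ^ cbasis) \<longleftrightarrow> \<tau> = tau_map"
proof -
  have tau_values: "tau_map (basis_elt (U 1)) = (basis_elt (U 1) :: 'f ^ cbasis)"
    "tau_map (basis_elt (U 2)) = (basis_elt (U 2) :: 'f ^ cbasis)"
    "tau_map (basis_elt (U 3)) =
      (basis_elt (U 3) + basis_elt (U 2) + basis_elt (V 3) - (basis_elt E1 - basis_elt E2)
        :: 'f ^ cbasis)"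
    by (simp_all add: tau_map_def cayley_vec_simps)
  show ?thesis
  proof
    assume tau: "is_tau \<tau>"
    show "\<tau> = tau_map"
    proof (rule cayley_Aut_eqI)
      show "\<tau> (basis_elt (U i)) = tau_map (basis_elt (U i))" for i
        using tau exhaust_3[of i] by (auto simp: is_tau_def tau_values)
    qed (use tau tau_map_in_Aut[OF three] in \<open>simp_all add: is_tau_def\<close>)
  qed (simp add: is_tau_def tau_map_in_Aut[OF three] tau_values)
qed

text \<open>Reduces commuting with \<tau> to a check on generators of
  \<open>unipotent_radical\<close>.\<close>

lemma (in group) subgroup_centralizer:
  assumes t: "t \<in> carrier G"
  shows "subgroup {g \<in> carrier G. g \<otimes> t = t \<otimes> g} G"
proof (rule subgroupI)
  fix g assume "g \<in> {g \<in> carrier G. g \<otimes> t = t \<otimes> g}"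
  then have g: "g \<in> carrier G" "g \<otimes> t = t \<otimes> g"
    by auto
  then have "inv g \<otimes> t = t \<otimes> inv g"
    using t by (metis inv_closed inv_solve_left inv_solve_right m_assoc m_closed)
  then show "inv g \<in> {g \<in> carrier G. g \<otimes> t = t \<otimes> g}"
    using g by simp
next
  fix g h assume "g \<in> {g \<in> carrier G. g \<otimes> t = t \<otimes> g}" "h \<in> {g \<in> carrier G. g \<otimes> t = t \<otimes> g}"
  then show "g \<otimes> h \<in> {g \<in> carrier G. g \<otimes> t = t \<otimes> g}"
    using t by (auto simp: m_assoc) (simp add: m_assoc[symmetric])
qed (use t in auto)

section \<open>Positive root elements in characteristic 3\<close>

locale comm_algebra_char3 = comm_algebra sc
  for sc :: "'f::field \<Rightarrow> 'r::comm_ring_1 \<Rightarrow> 'r" +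
  assumes CHAR_3: "CHAR('f) = 3"
begin

lemma three_eq_0: "(3 :: 'f) = 0" "(3 :: 'r) = 0"
proof -
  show three: "(3 :: 'f) = 0"
    using of_nat_CHAR[where 'a = 'f] by (simp add: CHAR_3)
  have "(3 :: 'r) = sc 1 1 + sc 1 1 + sc 1 1"
    by simp
  also have "\<dots> = sc (1 + 1 + 1) 1"
    by (simp only: scale_left_distrib)
  finally show "(3 :: 'r) = 0"
    by (simp add: three)
qed

lemmas char3_simps = char3_numerals[OF three_eq_0(1)] char3_numerals[OF three_eq_0(2)]

lemma scale_half: "sc (1 / 2) 1 = - 1"
  by (simp add: char3_simps)

definition root_elt :: "root \<Rightarrow> 'r \<Rightarrow> 'r ^ cbasis \<Rightarrow> 'r ^ cbasis" where
  "root_elt \<alpha> t = exp_trunc sc (\<lambda>x. t *s root_vector \<alpha> x)"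

text \<open>Long root vectors square to zero, so only short roots contribute \<open>t * t\<close>.
  Characteristic 3 turns the coefficients 2 coming from \<open>cayley_ad\<close> into signs.\<close>

lemma root_elt_cayley_vec:
  "root_elt (Eps 1) t (cayley_vec a b m1 m2 m3 n1 n2 n3) =
     cayley_vec (a - t * n1) (b + t * n1) (m1 + t * t * n1 - t * a + t * b) m2 m3
       n1 (n2 + t * m3) (n3 - t * m2)"
  "root_elt (Eps 2) t (cayley_vec a b m1 m2 m3 n1 n2 n3) =
     cayley_vec (a - t * n2) (b + t * n2) m1 (m2 + t * t * n2 - t * a + t * b) m3
       (n1 - t * m3) n2 (n3 + t * m1)"
  "root_elt (NegEps 3) t (cayley_vec a b m1 m2 m3 n1 n2 n3) =
     cayley_vec (a - t * m3) (b + t * m3) (m1 - t * n2) (m2 + t * n1) m3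
       n1 n2 (n3 + t * t * m3 - t * a + t * b)"
  "root_elt (EpsDiff 2 1) t (cayley_vec a b m1 m2 m3 n1 n2 n3) =
     cayley_vec a b m1 (m2 + t * m1) m3 (n1 - t * n2) n2 n3"
  "root_elt (EpsDiff 2 3) t (cayley_vec a b m1 m2 m3 n1 n2 n3) =
     cayley_vec a b m1 (m2 + t * m3) m3 n1 n2 (n3 - t * n2)"
  "root_elt (EpsDiff 1 3) t (cayley_vec a b m1 m2 m3 n1 n2 n3) =
     cayley_vec a b (m1 + t * m3) m2 m3 n1 n2 (n3 - t * n1)"
  by (simp_all add: root_elt_def exp_trunc_def cayley_ad_def cayley_vec_simps scale_half
      char3_simps algebra_simps)

text \<open>By the explicit formulas each axiom becomes a polynomial identity; the inverse has
  parameter \<open>- t\<close>.\<close>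

lemma root_elt_in_Aut:
  assumes "\<alpha> \<in> positive_roots"
  shows "root_elt \<alpha> t \<in> carrier cayley_Aut"
proof -
  note [simp] = root_elt_cayley_vec cayley_vec_simps
  have inverse: "root_elt \<alpha> t (root_elt \<alpha> (- t) x) = x" for t x
    using assms by (induction x rule: cayley_vec_induct)
      (auto simp: positive_roots_def algebra_simps)
  have "bij (root_elt \<alpha> t)"
    using inverse[of t] inverse[of "- t"]
    by (intro o_bij[where g = "root_elt \<alpha> (- t)"]) (simp_all add: fun_eq_iff)
  moreover have "root_elt \<alpha> t (x + y) = root_elt \<alpha> t x + root_elt \<alpha> t y"
    "root_elt \<alpha> t (x \<odot> y) = root_elt \<alpha> t x \<odot> root_elt \<alpha> t y" for x y
    using assms
    by (induction x rule: cayley_vec_induct; induction y rule: cayley_vec_induct;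
        auto simp: positive_roots_def algebra_simps)+
  moreover have "root_elt \<alpha> t (r *s x) = r *s root_elt \<alpha> t x"
    "cayley_norm (root_elt \<alpha> t x) = cayley_norm x" for r x
    using assms
    by (induction x rule: cayley_vec_induct; auto simp: positive_roots_def algebra_simps)+
  ultimately show ?thesis
    by (simp add: cayley_Aut_iff)
qed

text \<open>For \<open>Eps 1\<close> and \<open>Eps 2\<close> the two sides differ by terms with
  factor \<open>3 * t\<close>, in the directions of \<open>EpsDiff 1 3\<close> and
  \<open>EpsDiff 2 3\<close>; these vanish.\<close>

lemma root_elt_commutes_tau_map:
  assumes "\<alpha> \<in> positive_roots"
  shows "root_elt \<alpha> t (tau_map x) = tau_map (root_elt \<alpha> t x)"
  using assms by (induction x rule: cayley_vec_induct)
    (auto simp: positive_roots_def tau_map_def root_elt_cayley_vec char3_simps algebra_simps)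

text \<open>The matrix of \<open>tau_map\<close> has entries 0, 1 and -1 only, so the same formula
  serves over \<open>F\<close> and over \<open>R\<close>.\<close>

lemma base_change_tau_map: "base_change sc tau_map = tau_map"
proof
  fix x :: "'r ^ cbasis"
  show "base_change sc tau_map x = tau_map x"
    by (induction x rule: cayley_vec_induct)
      (simp add: base_change_def sum_cbasis tau_map_def basis_elt_cayley_vec vec_eq_iff
        forall_cbasis)
qed

lemma root_subgroup_eq: "root_subgroup sc \<alpha> = range (root_elt \<alpha>)"
  by (auto simp: root_subgroup_def root_elt_def)

lemma unipotent_radical_subset_centralizer:
  "unipotent_radical sc \<subseteq> centralizer_points sc tau_map"
proof -
  interpret Aut: group "cayley_Aut :: ('r ^ cbasis \<Rightarrow> 'r ^ cbasis) monoid"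
    by (rule group_cayley_Aut)
  have tau: "(tau_map :: 'r ^ cbasis \<Rightarrow> 'r ^ cbasis) \<in> carrier cayley_Aut"
    by (rule tau_map_in_Aut[OF three_eq_0(2)])
  have centralizer: "centralizer_points sc tau_map =
      {g \<in> carrier cayley_Aut. g \<otimes>\<^bsub>cayley_Aut\<^esub> tau_map = tau_map \<otimes>\<^bsub>cayley_Aut\<^esub> g}"
    by (simp add: centralizer_points_def base_change_tau_map cayley_Aut_def)
  have "(\<Union>\<alpha>\<in>positive_roots. root_subgroup sc \<alpha>) \<subseteq> centralizer_points sc tau_map"
    by (auto simp: root_subgroup_eq centralizer_points_def base_change_tau_map root_elt_in_Aut
        root_elt_commutes_tau_map fun_eq_iff)
  then show ?thesis
    unfolding unipotent_radical_def centralizer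
    by (intro Aut.generate_subgroup_incl Aut.subgroup_centralizer tau)
qed

lemma centralizer_subset_unipotent_radical:
  "centralizer_points sc tau_map \<subseteq> unipotent_radical sc"
proof
  fix g :: "'r ^ cbasis \<Rightarrow> 'r ^ cbasis"
  assume "g \<in> centralizer_points sc tau_map"
  then have g: "g \<in> carrier cayley_Aut" and comm: "g (tau_map x) = tau_map (g x)" for x
    by (auto simp: centralizer_points_def base_change_tau_map fun_eq_iff)
  obtain b c d p s1 s2 where g_values:
    "g (basis_elt (U 1)) = cayley_vec 0 0 1 b 0 0 0 c"
    "g (basis_elt (U 2)) = cayley_vec 0 0 0 1 0 0 0 d"
    "g (basis_elt (U 3)) = cayley_vec p (- p) s1 s2 1 (b * d - c) (- d)
       (p * p - s1 * (b * d - c) + s2 * d)"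
    by (rule centralizer_tau_map_values[OF three_eq_0(2) g comm])
  text \<open>The values of \<open>h\<close> below on the \<open>u\<^sub>i\<close> form a triangular system for its parameters, with this
    solution.\<close>
  define t4 where "t4 = c - b * d"
  define t3 where "t3 = d * t4 - p"
  define t2 where "t2 = s1 - d * t3"
  define t1 where "t1 = s2 + t3 * t4 + d * t4 * t4"
  note t_defs = t1_def t2_def t3_def t4_def
  \<comment> \<open>The innermost parameters come from the \<open>u_2\<close> coordinate of
    \<open>g u_1\<close> and the \<open>v_3\<close> coordinate of \<open>g u_2\<close>. Then
    \<open>t4\<close> matches the \<open>v_3\<close> coordinate of \<open>g u_1\<close>, and
    \<open>t3\<close>, \<open>t2\<close>, \<open>t1\<close> match the \<open>e_1\<close>,
    \<open>u_1\<close>, \<open>u_2\<close> coordinates of \<open>g u_3\<close>.\<close>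
  let ?h = "root_elt (EpsDiff 2 3) t1 \<circ> root_elt (EpsDiff 1 3) t2 \<circ> root_elt (NegEps 3) t3 \<circ>
    root_elt (Eps 2) t4 \<circ> root_elt (Eps 1) (- d) \<circ> root_elt (EpsDiff 2 1) b"
  have comp: "f \<circ> f' \<in> unipotent_radical sc"
    if "f \<in> unipotent_radical sc" "f' \<in> unipotent_radical sc" for f f'
    using that generate.eng[of f cayley_Aut _ f']
    by (simp add: unipotent_radical_def cayley_Aut_def)
  have incl: "root_elt \<alpha> t \<in> unipotent_radical sc" if "\<alpha> \<in> positive_roots" for \<alpha> t
    using that by (auto simp: unipotent_radical_def root_subgroup_eq intro!: generate.incl)
  have h: "?h \<in> unipotent_radical sc"
    by (intro comp incl) (simp_all add: positive_roots_def)
  then have h_Aut: "?h \<in> carrier cayley_Aut"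
    using unipotent_radical_subset_centralizer by (auto simp: centralizer_points_def)
  have "g = ?h"
  proof (rule cayley_Aut_eqI[OF g h_Aut])
    fix i
    show "g (basis_elt (U i)) = ?h (basis_elt (U i))"
      using exhaust_3[of i]
      by (elim disjE)
        (simp_all add: g_values,
         simp_all add: basis_elt_cayley_vec root_elt_cayley_vec t_defs algebra_simps)
  qed
  with h show "g \<in> unipotent_radical sc"
    by simp
qed

end

section \<open>The order of \<tau> and the theorem\<close>

lemma ord_tau_map:
  assumes three: "(3 :: 'a::comm_ring_1) = 0"
  shows "group.ord cayley_Aut (tau_map :: 'a ^ cbasis \<Rightarrow> 'a ^ cbasis) = 3"
proof -
  interpret Aut: group "cayley_Aut :: ('a ^ cbasis \<Rightarrow> 'a ^ cbasis) monoid"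
    by (rule group_cayley_Aut)
  let ?tau = "tau_map :: 'a ^ cbasis \<Rightarrow> 'a ^ cbasis"
  have tau: "?tau \<in> carrier cayley_Aut"
    by (rule tau_map_in_Aut[OF three])
  have "?tau [^]\<^bsub>cayley_Aut\<^esub> (3::nat) = \<one>\<^bsub>cayley_Aut\<^esub>"
    using tau_map_cube[OF three]
    by (simp add: numeral_3_eq_3 nat_pow_def) (simp add: cayley_Aut_def fun_eq_iff)
  then have "Aut.ord ?tau dvd 3"
    using Aut.pow_eq_id[OF tau] by simp
  \<comment> \<open>Order 1 is excluded because \<open>tau_map\<close> moves
    \<open>u_3\<close>.\<close>
  moreover have "Aut.ord ?tau \<noteq> 1"
  proof
    assume "Aut.ord ?tau = 1"
    then have "?tau = id"
      using Aut.ord_eq_1[OF tau] by (simp add: cayley_Aut_def)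
    then have "?tau (basis_elt (U 3)) = basis_elt (U 3)"
      by simp
    then show False
      by (simp add: tau_map_def basis_elt_cayley_vec)
  qed
  moreover have "n = 3" if "n dvd 3" "n \<noteq> 1" for n :: nat
    using that dvd_imp_le[of n 3] by (cases "n = 0"; cases "n = 2"; auto)
  ultimately show ?thesis
    by blast
qed

text \<open>As \<open>sc\<close> is an arbitrary algebra, the equality of point sets expresses
  equality of the two group functors.\<close>

theorem theorem7p3:
  fixes sc :: "'f::field \<Rightarrow> 'r::comm_ring_1 \<Rightarrow> 'r"
  assumes "CHAR('f) = 3"
    and "comm_algebra sc"
  shows "(\<exists>!\<tau> :: 'f ^ cbasis \<Rightarrow> 'f ^ cbasis. is_tau \<tau>) \<and>
    (\<forall>\<tau> :: 'f ^ cbasis \<Rightarrow> 'f ^ cbasis. is_tau \<tau> \<longrightarrow>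
       group.ord cayley_Aut \<tau> = 3 \<and>
       centralizer_points sc \<tau> = unipotent_radical sc)"
proof -
  interpret comm_algebra_char3 sc
    using assms by (simp add: comm_algebra_char3_def comm_algebra_char3_axioms_def)
  have "is_tau \<tau> \<longleftrightarrow> \<tau> = tau_map" for \<tau> :: "'f ^ cbasis \<Rightarrow> 'f ^ cbasis"
    by (rule is_tau_iff[OF three_eq_0(1)])
  moreover have "centralizer_points sc tau_map = unipotent_radical sc"
    using unipotent_radical_subset_centralizer centralizer_subset_unipotent_radical by blast
  ultimately show ?thesis
    using ord_tau_map[OF three_eq_0(1)] by simp
qed

end
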